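(* Let $a\ge b\ge c>0$ be real numbers. The curved surface area $\hat S_1$ of the hemiellipsoid $$z=c\left(1-\frac{x^2}{a^2}-\frac{y^2}{b^2}\right)^{1/2}$$ (whose axis is the positive direction of the $z$-axis) lying above the $x$-$y$ plane (i.e. $z=0$) is given by $$\hat S_1=\frac{2\pi b^2c^2}{a^2}\;F_1\left[2;\,\tfrac12,\,\tfrac12;\,\tfrac32;\;1-\frac{b^2}{a^2},\;1-\frac{c^2}{a^2}\right],$$ where $\left|1-\frac{b^2}{a^2}\right|<1$ (i.e. $0<\frac{b^2}{a^2}<2$) and $\left|1-\frac{c^2}{a^2}\right|<1$ (i.e. $0<\frac{c^2}{a^2}<2$).
   Context: The curved surface area of a surface $z=f(x,y)$ whose projection on the $x$-$y$ plane is a region $D$ is $\hat S=\iint_{D}\sqrt{1+\left(\frac{\partial z}{\partial x}\right)^2+\left(\frac{\partial z}{\partial y}\right)^2}\,dx\,dy$ (the flat base is not counted); here $D$ is the elliptical region $\frac{x^2}{a^2}+\frac{y^2}{b^2}\le 1$, the integrand being defined in its interior. Appell's function of the first kind is $$F_1[\alpha;\beta,\gamma;\delta;x,y]=\sum_{m,n=0}^{\infty}\frac{(\alpha)_{m+n}(\beta)_m(\gamma)_n}{(\delta)_{m+n}\,m!\,n!}x^m y^n,\qquad |x|<1,\ |y|<1,$$ where $(\alpha)_0=1$ and $(\alpha)_n=\alpha(\alpha+1)\cdots(\alpha+n-1)$ for $n\ge1$. *)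

theory Defs
  imports "HOL-Analysis.Analysis"
begin

definition appell_F1 ::
  "'a::real_normed_field \<Rightarrow> 'a \<Rightarrow> 'a \<Rightarrow> 'a \<Rightarrow> 'a \<Rightarrow> 'a \<Rightarrow> 'a" where
  "appell_F1 \<alpha> \<beta> \<gamma> \<delta> x y =
     (\<Sum>\<^sub>\<infinity>(m, n) \<in> (UNIV :: (nat \<times> nat) set).
        pochhammer \<alpha> (m + n) * pochhammer \<beta> m * pochhammer \<gamma> n
          / (pochhammer \<delta> (m + n) * fact m * fact n) * x ^ m * y ^ n)"

(* Area of the graph z = f x y over D.  Where a partial derivative does not exist,
   deriv has an unspecified value; for the half ellipsoid below this happens only on the
   boundary of the region, a null set. *)
definition curved_surface_area ::
  "(real \<Rightarrow> real \<Rightarrow> real) \<Rightarrow> (real \<times> real) set \<Rightarrow> real" where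
  "curved_surface_area f D =
     (LINT (x, y) : D | lebesgue.
        sqrt (1 + (deriv (\<lambda>t. f t y) x)\<^sup>2 + (deriv (\<lambda>t. f x t) y)\<^sup>2))"

definition elliptical_region :: "real \<Rightarrow> real \<Rightarrow> (real \<times> real) set" where
  "elliptical_region a b = {(x, y). x\<^sup>2 / a\<^sup>2 + y\<^sup>2 / b\<^sup>2 \<le> 1}"

definition hemiellipsoid :: "real \<Rightarrow> real \<Rightarrow> real \<Rightarrow> real \<Rightarrow> real \<Rightarrow> real" where
  "hemiellipsoid a b c x y = c * sqrt (1 - x\<^sup>2 / a\<^sup>2 - y\<^sup>2 / b\<^sup>2)"

end

theory Submission
  imports Defs "HOL-Probability.Distributions"
begin

text \<open>
  Projecting the unit hemisphere to its equatorial disc, where the area element is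
  \<open>1 / sqrt (1 - x^2 - y^2)\<close>, the surface area becomes \<open>a * b * c\<close> times the integral over the
  hemisphere of \<open>sqrt (x^2/a^2 + y^2/b^2 + z^2/c^2)\<close>. Against the Gaussian weight on the half
  space, polar coordinates turn the integral of a homogeneous function into a hemisphere integral
  times a one-dimensional moment. In the half space one may rescale the axes linearly: this moves
  the semi-axes out of the square root, which becomes the norm, and into the exponent, which
  becomes \<open>- norm^2 + X * y^2 + Y * z^2\<close>, where \<open>X\<close> and \<open>Y\<close> are the arguments of
  Appell's function. Expanding the exponential in \<open>X\<close> and \<open>Y\<close> and returning to the hemisphere
  termwise yields the double series. Everything is nonnegative, so the computation takes place in
  the extended nonnegative reals and no convergence has to be checked.
\<close>

section \<open>Hemisphere and half-space integrals\<close>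

text \<open>The surface integral of \<open>G\<close> over the open upper unit hemisphere, written as
  a graph over the equatorial disc. Iterated integrals, here and in \<open>half_int\<close>, let a
  substitution act on one axis at a time.\<close>

definition hemi_int :: "(real \<times> real \<times> real \<Rightarrow> ennreal) \<Rightarrow> ennreal" where
  "hemi_int G = (\<integral>\<^sup>+x. \<integral>\<^sup>+y. indicator {p. fst p ^ 2 + snd p ^ 2 < 1} (x, y) *
     ennreal (1 / sqrt (1 - x\<^sup>2 - y\<^sup>2)) * G (x, y, sqrt (1 - x\<^sup>2 - y\<^sup>2)) \<partial>lborel \<partial>lborel)"

definition half_int :: "(real \<times> real \<times> real \<Rightarrow> ennreal) \<Rightarrow> ennreal" where
  "half_int F = (\<integral>\<^sup>+x. \<integral>\<^sup>+y. \<integral>\<^sup>+z. indicator {0<..} z * F (x, y, z) \<partial>lborel \<partial>lborel \<partial>lborel)"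

section \<open>Polar coordinates in the half space\<close>

text \<open>Continuity from below of the measure with density \<open>h\<close>; it carries a
  substitution from compact intervals to half lines.\<close>

lemma nn_integral_incseq_SUP:
  fixes h :: "'a \<Rightarrow> ennreal"
  assumes [measurable]: "h \<in> borel_measurable M" "\<And>n. A n \<in> sets M" and "incseq A"
  shows "(\<integral>\<^sup>+x. h x * indicator (\<Union>n. A n) x \<partial>M) = (SUP n. \<integral>\<^sup>+x. h x * indicator (A n) x \<partial>M)"
proof -
  have "(SUP n. emeasure (density M h) (A n)) = emeasure (density M h) (\<Union>n. A n)"
    using assms by (intro SUP_emeasure_incseq) auto
  then show ?thesis
    by (simp add: emeasure_density)
qed

text \<open>Substitute \<open>r = sqrt (rho^2 + z^2)\<close>: at fixed horizontal distance rho from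
  the axis, the distance from the origin replaces the height, and the extra factor is dz/dr.\<close>

lemma nn_integral_sqrt_substitution:
  fixes f :: "real \<Rightarrow> ennreal"
  assumes [measurable]: "f \<in> borel_measurable borel" and "\<rho> > 0"
  shows "(\<integral>\<^sup>+z. indicator {0<..} z * f z \<partial>lborel) =
    (\<integral>\<^sup>+r. indicator {\<rho><..} r * ennreal (r / sqrt (r\<^sup>2 - \<rho>\<^sup>2)) * f (sqrt (r\<^sup>2 - \<rho>\<^sup>2)) \<partial>lborel)"
proof -
  define h where "h = (\<lambda>r. f (sqrt (r\<^sup>2 - \<rho>\<^sup>2)) * ennreal (r / sqrt (r\<^sup>2 - \<rho>\<^sup>2)))"
  define g where "g = (\<lambda>z. sqrt (\<rho>\<^sup>2 + z\<^sup>2))"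
  have [measurable]: "h \<in> borel_measurable borel"
    unfolding h_def by measurable
  have pos: "\<rho>\<^sup>2 + z\<^sup>2 > 0" for z
    using \<open>\<rho> > 0\<close> by (simp add: add_pos_nonneg)
  \<comment> \<open>The endpoint is \<open>Suc n\<close>, so that the interval never shrinks to a
    point.\<close>
  have sub: "(\<integral>\<^sup>+r. h r * indicator {\<rho>..g (Suc n)} r \<partial>lborel) =
      (\<integral>\<^sup>+z. f z * indicator {0..real (Suc n)} z \<partial>lborel)" for n
  proof -
    have "(\<integral>\<^sup>+r. h r * indicator {g 0..g (Suc n)} r \<partial>lborel) =
      (\<integral>\<^sup>+z. h (g z) * ennreal (z / g z) * indicator {0..real (Suc n)} z \<partial>lborel)"
    proof (rule nn_integral_substitution_aux)
      show "(g has_real_derivative z / g z) (at z)" for z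
        unfolding g_def using pos[of z]
        by (auto intro!: derivative_eq_intros simp: field_simps)
      show "continuous_on {0..real (Suc n)} (\<lambda>z. z / g z)"
        unfolding g_def using pos by (intro continuous_intros) (auto simp: less_imp_neq[symmetric])
    qed (auto simp: g_def)
    also have "\<dots> = (\<integral>\<^sup>+z. f z * indicator {0..real (Suc n)} z \<partial>lborel)"
    proof (rule nn_integral_cong_AE)
      \<comment> \<open>At \<open>z = 0\<close> the Jacobian vanishes and the weight in
        \<open>h\<close> divides by zero, so the two factors cancel only off this null set.\<close>
      have "AE z in lborel. z \<noteq> (0::real)"
        by (rule AE_lborel_singleton)
      then show "AE z in lborel. h (g z) * ennreal (z / g z) * indicator {0..real (Suc n)} z =
          f z * indicator {0..real (Suc n)} z"
      proof eventually_elim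
        case (elim z)
        have "h (g z) * ennreal (z / g z) = f z" if "z > 0"
        proof -
          have "h (g z) * ennreal (z / g z) = f z * (ennreal (g z / z) * ennreal (z / g z))"
            using pos[of z] that by (simp add: h_def g_def mult.assoc)
          also have "ennreal (g z / z) * ennreal (z / g z) = 1"
            using pos[of z] that by (subst ennreal_mult[symmetric]) (auto simp: g_def)
          finally show ?thesis by simp
        qed
        with elim show ?case by (auto split: split_indicator)
      qed
    qed
    finally show ?thesis using \<open>\<rho> > 0\<close> by (simp add: g_def)
  qed
  have g_ge: "g (Suc n) \<ge> n" for n
    unfolding g_def by (rule real_le_rsqrt) (simp add: power2_eq_square algebra_simps)
  have "incseq (\<lambda>n. {\<rho>..g (Suc n)})"
    unfolding g_def by (intro incseq_SucI) (auto intro: order_trans)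
  moreover have "(\<Union>n. {\<rho>..g (Suc n)}) = {\<rho>..}"
  proof (safe; simp)
    fix r :: real
    obtain n :: nat where "r \<le> n" using real_arch_simple by blast
    then show "\<exists>n. r \<le> g (1 + real n)" using g_ge[of n] by (auto intro!: exI[of _ n])
  qed
  ultimately have 1: "(\<integral>\<^sup>+r. h r * indicator {\<rho>..} r \<partial>lborel) =
      (SUP n. \<integral>\<^sup>+r. h r * indicator {\<rho>..g (Suc n)} r \<partial>lborel)"
    using nn_integral_incseq_SUP[of h lborel "\<lambda>n. {\<rho>..g (Suc n)}"] by simp
  have "(\<Union>n. {0..real (Suc n)}) = {0..}"
  proof (safe; simp)
    fix r :: real
    obtain n :: nat where "r \<le> n" using real_arch_simple by blast
    then show "\<exists>n. r \<le> 1 + real n" by (auto intro!: exI[of _ n])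
  qed
  moreover have "incseq (\<lambda>n. {0..real (Suc n)})"
    by (intro incseq_SucI) auto
  ultimately have 2: "(\<integral>\<^sup>+r. f r * indicator {0..} r \<partial>lborel) =
      (SUP n. \<integral>\<^sup>+r. f r * indicator {0..real (Suc n)} r \<partial>lborel)"
    using nn_integral_incseq_SUP[of f lborel "\<lambda>n. {0..real (Suc n)}"] by simp
  have "(\<integral>\<^sup>+z. indicator {0<..} z * f z \<partial>lborel) = (\<integral>\<^sup>+r. f r * indicator {0..} r \<partial>lborel)"
  proof (rule nn_integral_cong_AE)
    have "AE z in lborel. z \<noteq> (0::real)"
      by (rule AE_lborel_singleton)
    then show "AE z in lborel. indicator {0<..} z * f z = f z * indicator {0..} z"
      by eventually_elim (auto split: split_indicator)
  qed
  also have "\<dots> = (\<integral>\<^sup>+r. h r * indicator {\<rho>..} r \<partial>lborel)"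
    by (simp only: 1 2 sub)
  also have "\<dots> = (\<integral>\<^sup>+r. indicator {\<rho><..} r * ennreal (r / sqrt (r\<^sup>2 - \<rho>\<^sup>2)) * f (sqrt (r\<^sup>2 - \<rho>\<^sup>2)) \<partial>lborel)"
    by (intro nn_integral_cong) (auto simp: h_def mult.commute split: split_indicator)
  finally show ?thesis .
qed

text \<open>Replace z by the radius r at fixed x and y, move the r-integral outside by Tonelli, then
  scale x and y by r. The two scalings give \<open>r^2\<close>; the factor r in the numerator of
  dz/dr cancels against the scaled square root.\<close>

lemma half_int_polar:
  assumes [measurable]: "F \<in> borel_measurable borel"
  shows "half_int F = (\<integral>\<^sup>+r. indicator {0<..} r * ennreal (r\<^sup>2) * hemi_int (\<lambda>p. F (r *\<^sub>R p)) \<partial>lborel)"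
proof -
  define L where "L = (\<lambda>(x, y, r). indicator {0<..} r * (if x\<^sup>2 + y\<^sup>2 < r\<^sup>2 then
     ennreal (r / sqrt (r\<^sup>2 - x\<^sup>2 - y\<^sup>2)) * F (x, y, sqrt (r\<^sup>2 - x\<^sup>2 - y\<^sup>2)) else 0))"
  have L[measurable]: "L \<in> borel_measurable (borel \<Otimes>\<^sub>M borel \<Otimes>\<^sub>M borel)"
    unfolding L_def by measurable
  have "half_int F = (\<integral>\<^sup>+x. \<integral>\<^sup>+y. \<integral>\<^sup>+r. L (x, y, r) \<partial>lborel \<partial>lborel \<partial>lborel)"
    unfolding half_int_def
  proof (intro nn_integral_cong_AE)
    \<comment> \<open>The substitution needs a positive rho; discarding the null set
      \<open>x = 0\<close> guarantees it for every y.\<close>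
    show "AE x in lborel. (\<integral>\<^sup>+y. \<integral>\<^sup>+z. indicator {0<..} z * F (x, y, z) \<partial>lborel \<partial>lborel) =
      (\<integral>\<^sup>+y. \<integral>\<^sup>+r. L (x, y, r) \<partial>lborel \<partial>lborel)"
      using AE_lborel_singleton[of 0]
    proof eventually_elim
      case (elim x)
      show ?case
      proof (rule nn_integral_cong)
        fix y :: real
        define \<rho> where "\<rho> = sqrt (x\<^sup>2 + y\<^sup>2)"
        have r2: "\<rho>\<^sup>2 = x\<^sup>2 + y\<^sup>2" by (simp add: \<rho>_def)
        have "\<rho> > 0" using elim by (simp add: \<rho>_def add_pos_nonneg)
        have iff: "\<rho> < r \<longleftrightarrow> r > 0 \<and> x\<^sup>2 + y\<^sup>2 < r\<^sup>2" for r
          using \<open>\<rho> > 0\<close> unfolding r2[symmetric]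
          by (auto intro: power_strict_mono power2_less_imp_less)
        have "(\<integral>\<^sup>+z. indicator {0<..} z * F (x, y, z) \<partial>lborel) =
          (\<integral>\<^sup>+r. indicator {\<rho><..} r * ennreal (r / sqrt (r\<^sup>2 - \<rho>\<^sup>2)) * F (x, y, sqrt (r\<^sup>2 - \<rho>\<^sup>2)) \<partial>lborel)"
          by (rule nn_integral_sqrt_substitution) (use \<open>\<rho> > 0\<close> in measurable)
        also have "\<dots> = (\<integral>\<^sup>+r. L (x, y, r) \<partial>lborel)"
          by (intro nn_integral_cong)
             (auto simp: L_def r2 iff diff_diff_eq mult.assoc split: split_indicator)
        finally show "(\<integral>\<^sup>+z. indicator {0<..} z * F (x, y, z) \<partial>lborel) = (\<integral>\<^sup>+r. L (x, y, r) \<partial>lborel)" .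
      qed
    qed
  qed
  also have "\<dots> = (\<integral>\<^sup>+x. \<integral>\<^sup>+r. \<integral>\<^sup>+y. L (x, y, r) \<partial>lborel \<partial>lborel \<partial>lborel)"
    by (intro nn_integral_cong lborel_pair.Fubini') measurable
  also have "\<dots> = (\<integral>\<^sup>+r. \<integral>\<^sup>+x. \<integral>\<^sup>+y. L (x, y, r) \<partial>lborel \<partial>lborel \<partial>lborel)"
    by (intro lborel_pair.Fubini') measurable
  also have "\<dots> = (\<integral>\<^sup>+r. indicator {0<..} r * ennreal (r\<^sup>2) * hemi_int (\<lambda>p. F (r *\<^sub>R p)) \<partial>lborel)"
  proof (rule nn_integral_cong)
    fix r :: real
    show "(\<integral>\<^sup>+x. \<integral>\<^sup>+y. L (x, y, r) \<partial>lborel \<partial>lborel) = indicator {0<..} r * ennreal (r\<^sup>2) * hemi_int (\<lambda>p. F (r *\<^sub>R p))"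
    proof (cases "r > 0")
      case False
      then show ?thesis by (simp add: L_def)
    next
      case True
      have "(\<integral>\<^sup>+x. \<integral>\<^sup>+y. L (x, y, r) \<partial>lborel \<partial>lborel) =
         ennreal r * (\<integral>\<^sup>+x. \<integral>\<^sup>+y. L (r * x, y, r) \<partial>lborel \<partial>lborel)"
        by (subst nn_integral_real_affine[where c = r and t = 0]) (use True in auto)
      also have "(\<integral>\<^sup>+x. \<integral>\<^sup>+y. L (r * x, y, r) \<partial>lborel \<partial>lborel) =
         (\<integral>\<^sup>+x. ennreal r * (\<integral>\<^sup>+y. L (r * x, r * y, r) \<partial>lborel) \<partial>lborel)"
        by (subst nn_integral_real_affine[where c = r and t = 0]) (use True in auto)
      also have "\<dots> = ennreal r * (\<integral>\<^sup>+x. \<integral>\<^sup>+y. L (r * x, r * y, r) \<partial>lborel \<partial>lborel)"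
        by (rule nn_integral_cmult) measurable
      also have "(\<integral>\<^sup>+x. \<integral>\<^sup>+y. L (r * x, r * y, r) \<partial>lborel \<partial>lborel) = hemi_int (\<lambda>p. F (r *\<^sub>R p))"
        unfolding hemi_int_def
      proof (intro nn_integral_cong)
        fix x y :: real
        have 1: "(r * x)\<^sup>2 + (r * y)\<^sup>2 < r\<^sup>2 \<longleftrightarrow> x\<^sup>2 + y\<^sup>2 < 1"
        proof -
          have "(r * x)\<^sup>2 + (r * y)\<^sup>2 = r\<^sup>2 * (x\<^sup>2 + y\<^sup>2)" by (simp add: algebra_simps)
          moreover have "r\<^sup>2 * (x\<^sup>2 + y\<^sup>2) < r\<^sup>2 * 1 \<longleftrightarrow> x\<^sup>2 + y\<^sup>2 < 1"
            using True by (intro mult_less_cancel_left_pos) simp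
          ultimately show ?thesis by simp
        qed
        have "r\<^sup>2 - (r * x)\<^sup>2 - (r * y)\<^sup>2 = r\<^sup>2 * (1 - x\<^sup>2 - y\<^sup>2)"
          by (simp add: algebra_simps)
        then have 2: "sqrt (r\<^sup>2 - (r * x)\<^sup>2 - (r * y)\<^sup>2) = r * sqrt (1 - x\<^sup>2 - y\<^sup>2)"
          using True by (simp add: real_sqrt_mult)
        show "L (r * x, r * y, r) = indicator {p. (fst p)\<^sup>2 + (snd p)\<^sup>2 < 1} (x, y) *
            ennreal (1 / sqrt (1 - x\<^sup>2 - y\<^sup>2)) * F (r *\<^sub>R (x, y, sqrt (1 - x\<^sup>2 - y\<^sup>2)))"
          using True by (simp add: L_def 1 2)
      qed
      finally show ?thesis
        using True by (simp add: power2_eq_square ennreal_mult mult.assoc)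
    qed
  qed
  finally show ?thesis .
qed

text \<open>On the sphere of radius r the Gaussian is constant and \<open>G\<close> contributes
  \<open>r ^ k\<close>; with \<open>r^2\<close> from polar coordinates, the radial integral splits
  off as a moment of order \<open>k + 2\<close>.\<close>

lemma half_int_homogeneous:
  assumes [measurable]: "G \<in> borel_measurable borel"
    and hom: "\<And>r p. r > 0 \<Longrightarrow> G (r *\<^sub>R p) = ennreal (r ^ k) * G p"
  shows "half_int (\<lambda>p. ennreal (exp (- (norm p)\<^sup>2)) * G p) =
    (\<integral>\<^sup>+r. indicator {0<..} r * ennreal (r ^ (k + 2) * exp (- r\<^sup>2)) \<partial>lborel) * hemi_int G"
proof -
  have "half_int (\<lambda>p. ennreal (exp (- (norm p)\<^sup>2)) * G p) =
    (\<integral>\<^sup>+r. indicator {0<..} r * ennreal (r\<^sup>2) *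
      hemi_int (\<lambda>p. ennreal (exp (- (norm (r *\<^sub>R p))\<^sup>2)) * G (r *\<^sub>R p)) \<partial>lborel)"
    by (rule half_int_polar) measurable
  also have "\<dots> = (\<integral>\<^sup>+r. indicator {0<..} r * ennreal (r ^ (k + 2) * exp (- r\<^sup>2)) * hemi_int G \<partial>lborel)"
  proof (rule nn_integral_cong)
    fix r :: real
    show "indicator {0<..} r * ennreal (r\<^sup>2) *
      hemi_int (\<lambda>p. ennreal (exp (- (norm (r *\<^sub>R p))\<^sup>2)) * G (r *\<^sub>R p)) =
      indicator {0<..} r * ennreal (r ^ (k + 2) * exp (- r\<^sup>2)) * hemi_int G"
    proof (cases "r > 0")
      case True
      have "hemi_int (\<lambda>p. ennreal (exp (- (norm (r *\<^sub>R p))\<^sup>2)) * G (r *\<^sub>R p)) =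
        (\<integral>\<^sup>+x. \<integral>\<^sup>+y. ennreal (exp (- r\<^sup>2) * r ^ k) * (indicator {p. fst p ^ 2 + snd p ^ 2 < 1} (x, y) *
     ennreal (1 / sqrt (1 - x\<^sup>2 - y\<^sup>2)) * G (x, y, sqrt (1 - x\<^sup>2 - y\<^sup>2))) \<partial>lborel \<partial>lborel)"
        unfolding hemi_int_def
        using True
        by (intro nn_integral_cong)
           (auto simp: hom[OF True] norm_Pair ennreal_mult power_mult_distrib mult_ac simp del: scaleR_Pair split: split_indicator)
      also have "\<dots> = (\<integral>\<^sup>+x. ennreal (exp (- r\<^sup>2) * r ^ k) * (\<integral>\<^sup>+y. (indicator {p. fst p ^ 2 + snd p ^ 2 < 1} (x, y) *
     ennreal (1 / sqrt (1 - x\<^sup>2 - y\<^sup>2)) * G (x, y, sqrt (1 - x\<^sup>2 - y\<^sup>2))) \<partial>lborel) \<partial>lborel)"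
        by (intro nn_integral_cong nn_integral_cmult) measurable
      also have "\<dots> = ennreal (exp (- r\<^sup>2) * r ^ k) * hemi_int G"
        unfolding hemi_int_def by (intro nn_integral_cmult) measurable
      moreover have "ennreal (r ^ (k + 2) * exp (- r\<^sup>2)) = ennreal (r\<^sup>2) * ennreal (exp (- r\<^sup>2) * r ^ k)"
        using True by (subst ennreal_mult[symmetric]) (auto simp: power_add power2_eq_square mult_ac)
      ultimately show ?thesis using True
        by (simp add: mult.assoc)
    qed simp
  qed
  also have "\<dots> = (\<integral>\<^sup>+r. indicator {0<..} r * ennreal (r ^ (k + 2) * exp (- r\<^sup>2)) \<partial>lborel) * hemi_int G"
    by (rule nn_integral_multc) measurable
  finally show ?thesis .
qed

section \<open>Scaling and linearity of the half-space integral\<close>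

text \<open>A positive factor on z preserves the half space. The x-axis stays fixed as the reference
  for the ratios \<open>b / a\<close> and \<open>c / a\<close> used later.\<close>

lemma half_int_scale:
  assumes [measurable]: "F \<in> borel_measurable borel" and "\<beta> > 0" "\<gamma> > 0"
  shows "half_int F = ennreal (\<beta> * \<gamma>) * half_int (\<lambda>(x, y, z). F (x, \<beta> * y, \<gamma> * z))"
proof -
  have "half_int F = (\<integral>\<^sup>+x. ennreal \<beta> * (\<integral>\<^sup>+y. \<integral>\<^sup>+z. indicator {0<..} z * F (x, \<beta> * y, z) \<partial>lborel \<partial>lborel) \<partial>lborel)"
    unfolding half_int_def
    by (subst nn_integral_real_affine[where c = \<beta> and t = 0]) (use assms in auto)
  also have "\<dots> = (\<integral>\<^sup>+x. ennreal \<beta> * (\<integral>\<^sup>+y. ennreal \<gamma> * (\<integral>\<^sup>+z. indicator {0<..} z * F (x, \<beta> * y, \<gamma> * z) \<partial>lborel) \<partial>lborel) \<partial>lborel)"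
    using assms
    by (subst nn_integral_real_affine[where c = \<gamma> and t = 0])
       (auto intro!: nn_integral_cong arg_cong2[where f = "(*)"] simp: zero_less_mult_iff split: split_indicator)
  also have "\<dots> = ennreal (\<beta> * \<gamma>) * half_int (\<lambda>(x, y, z). F (x, \<beta> * y, \<gamma> * z))"
    unfolding half_int_def using assms
    by (simp add: nn_integral_cmult ennreal_mult mult.assoc)
  finally show ?thesis .
qed

lemma half_int_cmult:
  assumes [measurable]: "F \<in> borel_measurable borel"
  shows "half_int (\<lambda>p. c * F p) = c * half_int F"
  unfolding half_int_def by (simp add: mult.left_commute[of _ c] nn_integral_cmult)

lemma half_int_suminf:
  assumes [measurable]: "\<And>n. F n \<in> borel_measurable borel"
  shows "half_int (\<lambda>p. \<Sum>n. F n p) = (\<Sum>n. half_int (F n))"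
  unfolding half_int_def by (simp flip: ennreal_suminf_cmult add: nn_integral_suminf)

section \<open>One-dimensional Gaussian moments and monomial moments of the hemisphere\<close>

lemma has_bochner_integral_nn_integral_eq:
  assumes "has_bochner_integral M f x" and "\<And>t. 0 \<le> f t"
  shows "(\<integral>\<^sup>+t. ennreal (f t) \<partial>M) = ennreal x"
  using assms nn_integral_eq_integral[of M f] by (auto simp: has_bochner_integral_iff)

lemma nn_integral_gaussian_odd:
  "(\<integral>\<^sup>+r. indicator {0<..} r * ennreal (r ^ (2 * k + 1) * exp (- r\<^sup>2)) \<partial>lborel) = ennreal (fact k / 2)"
proof -
  let ?f = "\<lambda>r::real. indicator {0..} r *\<^sub>R (exp (- r\<^sup>2) * r ^ (2 * k + 1))"
  have "(\<integral>\<^sup>+r. indicator {0<..} r * ennreal (r ^ (2 * k + 1) * exp (- r\<^sup>2)) \<partial>lborel) =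
      (\<integral>\<^sup>+r. ennreal (?f r) \<partial>lborel)"
    by (intro nn_integral_cong) (simp add: mult_ac indicator_def)
  also have "\<dots> = ennreal (fact k / 2)"
    using gaussian_moment_odd_pos[of k]
    by (rule has_bochner_integral_nn_integral_eq) (auto split: split_indicator)
  finally show ?thesis .
qed

text \<open>The duplication formula (2k)! = 4^k (1/2)_k k! brings the constant of the even moments
  into Pochhammer form.\<close>

lemma gaussian_moment_even_pochhammer:
  "sqrt pi / 2 * (fact (2 * k) / (2 ^ (2 * k) * fact k)) = sqrt pi / 2 * pochhammer (1/2) k"
  by (subst fact_double) simp

lemma nn_integral_gaussian_even:
  "(\<integral>\<^sup>+r. indicator {0<..} r * ennreal (r ^ (2 * k) * exp (- r\<^sup>2)) \<partial>lborel) =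
     ennreal (sqrt pi / 2 * pochhammer (1/2) k)"
proof -
  let ?f = "\<lambda>r::real. indicator {0..} r *\<^sub>R (exp (- r\<^sup>2) * r ^ (2 * k))"
  have "(\<integral>\<^sup>+r. indicator {0<..} r * ennreal (r ^ (2 * k) * exp (- r\<^sup>2)) \<partial>lborel) =
      (\<integral>\<^sup>+r. ennreal (?f r) \<partial>lborel)"
  proof (rule nn_integral_cong_AE)
    \<comment> \<open>For \<open>k = 0\<close> the integrands differ at \<open>r = 0\<close>, so
      equality is only almost everywhere; odd powers vanish there.\<close>
    show "AE r in lborel. indicator {0<..} r * ennreal (r ^ (2 * k) * exp (- r\<^sup>2)) = ennreal (?f r)"
      using AE_lborel_singleton[of 0]
      by eventually_elim (auto simp: mult_ac split: split_indicator)
  qed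
  also have "\<dots> = ennreal (sqrt pi / 2 * pochhammer (1/2) k)"
    using gaussian_moment_even_pos[of k] unfolding gaussian_moment_even_pochhammer
    by (rule has_bochner_integral_nn_integral_eq) (auto split: split_indicator)
  finally show ?thesis .
qed

lemma nn_integral_gaussian_even_line:
  "(\<integral>\<^sup>+r. ennreal (r ^ (2 * k) * exp (- r\<^sup>2)) \<partial>lborel) = ennreal (sqrt pi * pochhammer (1/2) k)"
proof -
  have "has_bochner_integral lborel (\<lambda>r::real. exp (- r\<^sup>2) * r ^ (2 * k)) (2 *\<^sub>R (sqrt pi / 2 * pochhammer (1/2) k))"
    using gaussian_moment_even_pos[of k] unfolding gaussian_moment_even_pochhammer
    by (rule has_bochner_integral_even_function) simp
  then have "(\<integral>\<^sup>+r. ennreal (exp (- r\<^sup>2) * r ^ (2 * k)) \<partial>lborel) = ennreal (2 *\<^sub>R (sqrt pi / 2 * pochhammer (1/2) k))"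
    by (rule has_bochner_integral_nn_integral_eq) (auto intro!: mult_nonneg_nonneg pochhammer_nonneg)
  then show ?thesis by (simp add: mult_ac)
qed

text \<open>
  Evaluates the Gaussian integral of the monomial over the half space twice, in polar and in
  Cartesian coordinates, and compares.
\<close>

lemma hemi_int_moment:
  "hemi_int (\<lambda>(x, y, z). ennreal (y ^ (2 * m) * z ^ (2 * n))) =
    ennreal (2 * pi * (pochhammer (1/2) m * pochhammer (1/2) n / pochhammer (3/2) (m + n)))"
proof -
  define G where "G = (\<lambda>(x::real, y::real, z::real). ennreal (y ^ (2 * m) * z ^ (2 * n)))"
  have G[measurable]: "G \<in> borel_measurable borel"
    unfolding G_def by (subst borel_prod[symmetric])+ measurable
  have "half_int (\<lambda>p. ennreal (exp (- (norm p)\<^sup>2)) * G p) =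
    (\<integral>\<^sup>+r. indicator {0<..} r * ennreal (r ^ (2 * (m + n) + 2) * exp (- r\<^sup>2)) \<partial>lborel) * hemi_int G"
    by (rule half_int_homogeneous[OF G])
       (auto simp: G_def power_mult_distrib power_add power_mult ennreal_mult[symmetric] mult_ac split: prod.split)
  also have "2 * (m + n) + 2 = 2 * (m + n + 1)"
    by simp
  also have "(\<integral>\<^sup>+r. indicator {0<..} r * ennreal (r ^ (2 * (m + n + 1)) * exp (- r\<^sup>2)) \<partial>lborel) =
      ennreal (sqrt pi / 2 * pochhammer (1/2) (m + n + 1))"
    by (rule nn_integral_gaussian_even)
  \<comment> \<open>Splitting off the first factor 1/2 shifts the parameter to 3/2, the lower
    parameter of Appell's function.\<close>
  also have "sqrt pi / 2 * pochhammer (1/2) (m + n + 1) = sqrt pi / 4 * pochhammer (3/2) (m + n)"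
    by (simp add: pochhammer_rec)
  finally have 1: "half_int (\<lambda>p. ennreal (exp (- (norm p)\<^sup>2)) * G p) =
    ennreal (sqrt pi / 4 * pochhammer (3/2) (m + n)) * hemi_int G" .
  \<comment> \<open>The Gaussian factorises over the axes. Writing \<open>x ^ (2 * 0)\<close> makes
    the x-integral a moment of the same shape as the y-integral.\<close>
  have "half_int (\<lambda>p. ennreal (exp (- (norm p)\<^sup>2)) * G p) =
    (\<integral>\<^sup>+x. \<integral>\<^sup>+y. \<integral>\<^sup>+z. ennreal (x ^ (2 * 0) * exp (- x\<^sup>2)) * (ennreal (y ^ (2 * m) * exp (- y\<^sup>2)) *
       (indicator {0<..} z * ennreal (z ^ (2 * n) * exp (- z\<^sup>2)))) \<partial>lborel \<partial>lborel \<partial>lborel)"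
    unfolding half_int_def
  proof (intro nn_integral_cong)
    fix x y z :: real
    have "- (norm (x, y, z))\<^sup>2 = - x\<^sup>2 + (- y\<^sup>2 + - z\<^sup>2)"
      by (simp add: norm_Pair)
    then show "indicator {0<..} z * (ennreal (exp (- (norm (x, y, z))\<^sup>2)) * G (x, y, z)) =
        ennreal (x ^ (2 * 0) * exp (- x\<^sup>2)) * (ennreal (y ^ (2 * m) * exp (- y\<^sup>2)) *
       (indicator {0<..} z * ennreal (z ^ (2 * n) * exp (- z\<^sup>2))))"
      by (simp only: exp_add) (simp add: G_def ennreal_mult, simp only: mult_ac)
  qed
  also have "\<dots> = ennreal (sqrt pi * pochhammer (1/2) 0) *
     (ennreal (sqrt pi * pochhammer (1/2) m) * ennreal (sqrt pi / 2 * pochhammer (1/2) n))"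
    by (simp add: nn_integral_cmult nn_integral_multc nn_integral_gaussian_even nn_integral_gaussian_even_line
        nn_integral_gaussian_even_line[of 0, simplified])
  also have "\<dots> = ennreal (sqrt pi / 4 * (2 * pi * (pochhammer (1/2) m * pochhammer (1/2) n)))"
    by (simp add: ennreal_mult[symmetric] pochhammer_nonneg mult_ac)
  finally have 2: "ennreal (sqrt pi / 4 * pochhammer (3/2) (m + n)) * hemi_int G =
     ennreal (sqrt pi / 4 * (2 * pi * (pochhammer (1/2) m * pochhammer (1/2) n)))"
    using 1 by simp
  have pos: "pochhammer (3/2 :: real) (m + n) > 0"
    by (simp add: pochhammer_pos)
  \<comment> \<open>The constant is positive and finite, so it can be cancelled in the extended
    reals by its inverse.\<close>
  have "hemi_int G = ennreal (inverse (sqrt pi / 4 * pochhammer (3/2) (m + n))) *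
      (ennreal (sqrt pi / 4 * pochhammer (3/2) (m + n)) * hemi_int G)"
    unfolding mult.assoc[symmetric] using pos by (subst ennreal_mult[symmetric]) auto
  also have "\<dots> = ennreal (2 * pi * (pochhammer (1/2) m * pochhammer (1/2) n / pochhammer (3/2) (m + n)))"
    unfolding 2 using pos
    by (subst ennreal_mult[symmetric]) (auto simp: pochhammer_nonneg field_simps)
  finally show ?thesis
    by (simp add: G_def)
qed

section \<open>Exponential and Appell series in the extended nonnegative reals\<close>

lemma ennreal_exp_eq_suminf:
  assumes "0 \<le> x"
  shows "ennreal (exp x) = (\<Sum>n. ennreal (x ^ n / fact n))"
  using exp_converges[of x] assms
  by (intro suminf_ennreal_eq[symmetric]) (auto simp: divide_inverse mult.commute)

text \<open>With these signs every term is nonnegative, so the sum over pairs is an integral for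
  counting measure, which Tonelli turns into an iterated series.\<close>

lemma appell_F1_eq_enn2real:
  fixes \<alpha> \<beta> \<gamma> \<delta> x y :: real
  assumes "\<alpha> > 0" "\<beta> > 0" "\<gamma> > 0" "\<delta> > 0" "0 \<le> x" "0 \<le> y"
  shows "appell_F1 \<alpha> \<beta> \<gamma> \<delta> x y = enn2real (\<Sum>m. \<Sum>n. ennreal
        (pochhammer \<alpha> (m + n) * pochhammer \<beta> m * pochhammer \<gamma> n
          / (pochhammer \<delta> (m + n) * fact m * fact n) * x ^ m * y ^ n))"
proof -
  define T where "T = (\<lambda>(m, n). pochhammer \<alpha> (m + n) * pochhammer \<beta> m * pochhammer \<gamma> n
          / (pochhammer \<delta> (m + n) * fact m * fact n) * x ^ m * y ^ n)"
  have T: "T p \<ge> 0" for p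
    using assms by (auto simp: T_def pochhammer_nonneg split: prod.split)
  \<comment> \<open>if the series diverges, both sides are \<open>0\<close> by convention\<close>
  have "infsum T UNIV = infsetsum T UNIV"
  proof (cases "T summable_on UNIV")
    case True
    then have "Infinite_Set_Sum.abs_summable_on T UNIV"
      using T by (simp flip: abs_summable_equivalent)
    then show ?thesis by (rule infsetsum_infsum[symmetric])
  next
    case False
    then have "\<not> Infinite_Set_Sum.abs_summable_on T UNIV"
      using T by (simp flip: abs_summable_equivalent)
    with False show ?thesis
      by (simp add: not_summable_infsetsum_eq infsum_not_exists)
  qed
  also have "\<dots> = enn2real (\<integral>\<^sup>+p. ennreal (T p) \<partial>count_space UNIV)"
    unfolding infsetsum_def using T by (intro integral_eq_nn_integral) auto
  also have "(\<integral>\<^sup>+p. ennreal (T p) \<partial>count_space UNIV) = (\<Sum>m. \<Sum>n. ennreal (T (m, n)))"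
    by (simp add: nn_integral_fst_count_space[symmetric] nn_integral_count_space_nat)
  finally show ?thesis
    by (simp add: appell_F1_def T_def)
qed

section \<open>Series for the hemisphere integral of the ellipsoid weight\<close>

text \<open>At a unit normal (x, y, z), \<open>a * b * c\<close> times this weight is the factor by
  which the linear map diag(a, b, c) stretches surface area.\<close>

definition ellipsoid_weight :: "real \<Rightarrow> real \<Rightarrow> real \<Rightarrow> real \<times> real \<times> real \<Rightarrow> ennreal" where
  "ellipsoid_weight a b c = (\<lambda>(x, y, z). ennreal (sqrt (x\<^sup>2 / a\<^sup>2 + y\<^sup>2 / b\<^sup>2 + z\<^sup>2 / c\<^sup>2)))"

text \<open>The ordering of the semi-axes makes \<open>X\<close> and \<open>Y\<close> nonnegative,
  hence all terms of the expansion. In each coefficient, the numerator parameter 2 comes from a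
  radial moment and 3/2 from the monomial moments of the hemisphere.\<close>

lemma hemi_int_ellipsoid_weight:
  fixes a b c :: real
  assumes "a \<ge> b" "b \<ge> c" "c > 0"
  defines "X \<equiv> 1 - b\<^sup>2 / a\<^sup>2" and "Y \<equiv> 1 - c\<^sup>2 / a\<^sup>2"
  shows "hemi_int (ellipsoid_weight a b c) = ennreal (2 * pi * b * c / a ^ 3) *
    (\<Sum>m. \<Sum>n. ennreal (pochhammer 2 (m + n) * pochhammer (1/2) m * pochhammer (1/2) n
          / (pochhammer (3/2) (m + n) * fact m * fact n) * X ^ m * Y ^ n))"
proof -
  have pos: "a > 0" "b > 0" "c > 0" using assms by auto
  have XY: "X \<ge> 0" "Y \<ge> 0"
    using assms pos by (auto simp: X_def Y_def)
  define G where "G = (\<lambda>m n (x::real, y::real, z::real). ennreal (y ^ (2 * m) * z ^ (2 * n)))"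
  define N where "N = (\<lambda>p::real \<times> real \<times> real. ennreal (norm p))"
  define E where "E = (\<lambda>p::real \<times> real \<times> real. ennreal (exp (- (norm p)\<^sup>2)))"
  have W[measurable]: "ellipsoid_weight a b c \<in> borel_measurable borel"
    unfolding ellipsoid_weight_def by (subst borel_prod[symmetric])+ measurable
  have G[measurable]: "G m n \<in> borel_measurable borel" for m n
    unfolding G_def by (subst borel_prod[symmetric])+ measurable
  have [measurable]: "N \<in> borel_measurable borel" "E \<in> borel_measurable borel"
    unfolding N_def E_def by measurable
  \<comment> \<open>The function \<open>N * G m n\<close> is homogeneous of degree
    \<open>2 * (m + n) + 1\<close>, so its radial moment is odd and yields a factorial.\<close>
  have summand: "half_int (\<lambda>p. E p * (N p * G m n p)) =
    ennreal (pi * (pochhammer 2 (m + n) * pochhammer (1/2) m * pochhammer (1/2) n / pochhammer (3/2) (m + n)))" for m n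
  proof -
    have "half_int (\<lambda>p. E p * (N p * G m n p)) =
      (\<integral>\<^sup>+r. indicator {0<..} r * ennreal (r ^ (2 * (m + n) + 1 + 2) * exp (- r\<^sup>2)) \<partial>lborel) * hemi_int (\<lambda>p. N p * G m n p)"
      unfolding E_def
    proof (rule half_int_homogeneous)
      fix r :: real and p :: "real \<times> real \<times> real"
      assume "r > 0"
      then have "N (r *\<^sub>R p) = ennreal r * N p" "G m n (r *\<^sub>R p) = ennreal (r ^ (2 * (m + n))) * G m n p"
        by (auto simp: N_def G_def power_mult_distrib power_add power_mult ennreal_mult[symmetric] mult_ac split: prod.split)
      moreover have "ennreal (r ^ (2 * (m + n) + 1)) = ennreal r * ennreal (r ^ (2 * (m + n)))"
        using \<open>r > 0\<close> by (subst ennreal_mult[symmetric]) auto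
      ultimately show "N (r *\<^sub>R p) * G m n (r *\<^sub>R p) = ennreal (r ^ (2 * (m + n) + 1)) * (N p * G m n p)"
        by (simp add: mult_ac)
    qed measurable
    also have "2 * (m + n) + 1 + 2 = 2 * (m + n + 1) + 1"
      by simp
    also have "(\<integral>\<^sup>+r. indicator {0<..} r * ennreal (r ^ (2 * (m + n + 1) + 1) * exp (- r\<^sup>2)) \<partial>lborel) =
        ennreal (fact (m + n + 1) / 2)"
      by (rule nn_integral_gaussian_odd)
    \<comment> \<open>(1)_{k+1} = (2)_k, with k = m + n.\<close>
    also have "fact (m + n + 1) = (pochhammer 2 (m + n) :: real)"
      unfolding pochhammer_fact by (simp add: pochhammer_rec)
    \<comment> \<open>The norm equals 1 on the hemisphere.\<close>
    also have "hemi_int (\<lambda>p. N p * G m n p) = hemi_int (G m n)"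
      unfolding hemi_int_def
      by (intro nn_integral_cong) (auto simp: N_def norm_Pair split: split_indicator)
    also have "\<dots> = ennreal (2 * pi * (pochhammer (1/2) m * pochhammer (1/2) n / pochhammer (3/2) (m + n)))"
      unfolding G_def by (rule hemi_int_moment)
    finally show ?thesis
      by (simp add: ennreal_mult[symmetric] pochhammer_nonneg mult_ac)
  qed
  have "half_int (\<lambda>p. E p * ellipsoid_weight a b c p) =
    (\<integral>\<^sup>+r. indicator {0<..} r * ennreal (r ^ (1 + 2) * exp (- r\<^sup>2)) \<partial>lborel) * hemi_int (ellipsoid_weight a b c)"
    unfolding E_def
  proof (rule half_int_homogeneous)
    fix r :: real and p :: "real \<times> real \<times> real"
    assume "r > 0"
    obtain x y z where p: "p = (x, y, z)" by (cases p) auto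
    have "(r * x)\<^sup>2 / a\<^sup>2 + (r * y)\<^sup>2 / b\<^sup>2 + (r * z)\<^sup>2 / c\<^sup>2 = r\<^sup>2 * (x\<^sup>2 / a\<^sup>2 + y\<^sup>2 / b\<^sup>2 + z\<^sup>2 / c\<^sup>2)"
      by (simp add: algebra_simps)
    then have "sqrt ((r * x)\<^sup>2 / a\<^sup>2 + (r * y)\<^sup>2 / b\<^sup>2 + (r * z)\<^sup>2 / c\<^sup>2) = r * sqrt (x\<^sup>2 / a\<^sup>2 + y\<^sup>2 / b\<^sup>2 + z\<^sup>2 / c\<^sup>2)"
      using \<open>r > 0\<close> by (simp add: real_sqrt_mult)
    then show "ellipsoid_weight a b c (r *\<^sub>R p) = ennreal (r ^ 1) * ellipsoid_weight a b c p"
      using \<open>r > 0\<close> by (simp add: ellipsoid_weight_def p ennreal_mult)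
  qed measurable
  \<comment> \<open>The weight has degree 1, so the radial factor is the third moment, 1!/2.\<close>
  also have "(\<integral>\<^sup>+r. indicator {0<..} r * ennreal (r ^ (1 + 2) * exp (- r\<^sup>2)) \<partial>lborel) = ennreal (1 / 2)"
  proof -
    have "1 + 2 = 2 * 1 + (1::nat)" by simp
    then show ?thesis by (simp only: nn_integral_gaussian_odd fact_1)
  qed
  finally have "half_int (\<lambda>p. E p * ellipsoid_weight a b c p) = ennreal (1 / 2) * hemi_int (ellipsoid_weight a b c)" .
  then have "ennreal 2 * half_int (\<lambda>p. E p * ellipsoid_weight a b c p) = (ennreal 2 * ennreal (1/2)) * hemi_int (ellipsoid_weight a b c)"
    by (simp only: mult.assoc)
  also have "ennreal 2 * ennreal (1/2) = 1"
    by (subst ennreal_mult[symmetric]) auto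
  finally have 1: "hemi_int (ellipsoid_weight a b c) = ennreal 2 * half_int (\<lambda>p. E p * ellipsoid_weight a b c p)"
    by simp
  \<comment> \<open>These ratios give all three squares in the weight the common denominator
    \<open>a^2\<close>, so that it becomes \<open>norm p / a\<close>.\<close>
  have scaled: "half_int (\<lambda>p. E p * ellipsoid_weight a b c p) = ennreal ((b / a) * (c / a)) *
    half_int (\<lambda>(x, y, z). E (x, b / a * y, c / a * z) * ellipsoid_weight a b c (x, b / a * y, c / a * z))"
    by (rule half_int_scale) (use pos in auto)
  have integrand: "(\<lambda>(x, y, z). E (x, b / a * y, c / a * z) * ellipsoid_weight a b c (x, b / a * y, c / a * z)) =
    (\<lambda>p. ennreal (1 / a) * (\<Sum>m. \<Sum>n. ennreal (X ^ m * Y ^ n / (fact m * fact n)) * (E p * (N p * G m n p))))"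
  proof (rule ext, safe)
    fix x y z :: real
    define p where "p = (x, y, z)"
    have "x\<^sup>2 / a\<^sup>2 + (b / a * y)\<^sup>2 / b\<^sup>2 + (c / a * z)\<^sup>2 / c\<^sup>2 = (norm p / a)\<^sup>2"
      using pos by (simp add: p_def norm_Pair power_divide power_mult_distrib add_divide_distrib)
    then have w: "ellipsoid_weight a b c (x, b / a * y, c / a * z) = ennreal (1 / a) * N p"
      using pos by (simp add: ellipsoid_weight_def N_def ennreal_mult[symmetric])
    \<comment> \<open>Here \<open>b^2 / a^2 = 1 - X\<close> and
      \<open>c^2 / a^2 = 1 - Y\<close>.\<close>
    have "- (norm (x, b / a * y, c / a * z))\<^sup>2 = - (norm p)\<^sup>2 + (X * y\<^sup>2 + Y * z\<^sup>2)"
      by (simp add: p_def norm_Pair X_def Y_def power_mult_distrib power_divide algebra_simps)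
    then have E: "E (x, b / a * y, c / a * z) = E p * (ennreal (exp (X * y\<^sup>2)) * ennreal (exp (Y * z\<^sup>2)))"
      by (simp only: E_def exp_add) (simp add: ennreal_mult)
    have coeff: "ennreal ((X * y\<^sup>2) ^ m / fact m) * ennreal ((Y * z\<^sup>2) ^ n / fact n) =
        ennreal (X ^ m * Y ^ n / (fact m * fact n)) * G m n p" for m n
    proof -
      have "(X * y\<^sup>2) ^ m / fact m * ((Y * z\<^sup>2) ^ n / fact n) =
          X ^ m * Y ^ n / (fact m * fact n) * (y ^ (2 * m) * z ^ (2 * n))"
        by (simp add: power_mult_distrib power_mult)
      moreover have "0 \<le> y ^ (2 * m) * z ^ (2 * n)"
        by (simp add: zero_le_mult_iff)
      ultimately show ?thesis
        using XY by (simp add: G_def p_def flip: ennreal_mult)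
    qed
    have "ennreal (exp (X * y\<^sup>2)) * ennreal (exp (Y * z\<^sup>2)) =
       (\<Sum>m. \<Sum>n. ennreal ((X * y\<^sup>2) ^ m / fact m) * ennreal ((Y * z\<^sup>2) ^ n / fact n))"
      using XY by (simp add: ennreal_exp_eq_suminf)
    then have e: "E (x, b / a * y, c / a * z) = E p * (\<Sum>m. \<Sum>n. ennreal (X ^ m * Y ^ n / (fact m * fact n)) * G m n p)"
      by (simp only: E coeff)
    have ac: "(e * s) * (i * n) = i * ((e * n) * s)" for e s i n :: ennreal
      by (simp only: mult_ac)
    have cmult: "e * (\<Sum>m. \<Sum>n. k m n * g m n) = (\<Sum>m. \<Sum>n. k m n * (e * g m n))"
      for e :: ennreal and k g
      by (simp add: mult.left_commute[of _ e])
    have "(E p * (\<Sum>m. \<Sum>n. ennreal (X ^ m * Y ^ n / (fact m * fact n)) * G m n p)) * (ennreal (1 / a) * N p) =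
      ennreal (1 / a) * (\<Sum>m. \<Sum>n. ennreal (X ^ m * Y ^ n / (fact m * fact n)) * (E p * (N p * G m n p)))"
      unfolding ac[of "E p"] cmult[of "E p * N p"] by (simp only: mult.assoc)
    then show "E (x, b / a * y, c / a * z) * ellipsoid_weight a b c (x, b / a * y, c / a * z) =
        ennreal (1 / a) * (\<Sum>m. \<Sum>n. ennreal (X ^ m * Y ^ n / (fact m * fact n)) * (E (x,y,z) * (N (x,y,z) * G m n (x,y,z))))"
      unfolding e w by (simp only: p_def)
  qed
  have "half_int (\<lambda>p. ennreal (1 / a) * (\<Sum>m. \<Sum>n. ennreal (X ^ m * Y ^ n / (fact m * fact n)) * (E p * (N p * G m n p)))) =
    ennreal (1 / a) * (\<Sum>m. \<Sum>n. ennreal (X ^ m * Y ^ n / (fact m * fact n)) *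
       half_int (\<lambda>p. E p * (N p * G m n p)))"
    by (simp add: half_int_cmult half_int_suminf)
  also have "\<dots> = ennreal (1 / a) * (\<Sum>m. \<Sum>n. ennreal pi *
      ennreal (pochhammer 2 (m + n) * pochhammer (1/2) m * pochhammer (1/2) n
          / (pochhammer (3/2) (m + n) * fact m * fact n) * X ^ m * Y ^ n))"
  proof -
    have "ennreal (X ^ m * Y ^ n / (fact m * fact n)) * half_int (\<lambda>p. E p * (N p * G m n p)) =
      ennreal pi * ennreal (pochhammer 2 (m + n) * pochhammer (1/2) m * pochhammer (1/2) n
          / (pochhammer (3/2) (m + n) * fact m * fact n) * X ^ m * Y ^ n)" for m n
      unfolding summand
      using XY by (subst (1 2) ennreal_mult[symmetric]) (simp_all add: pochhammer_nonneg mult_ac)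
    then show ?thesis by simp
  qed
  finally have 2: "half_int (\<lambda>p. E p * ellipsoid_weight a b c p) = ennreal (b / a * (c / a)) * (ennreal (1 / a) * (ennreal pi *
     (\<Sum>m. \<Sum>n. ennreal (pochhammer 2 (m + n) * pochhammer (1/2) m * pochhammer (1/2) n
          / (pochhammer (3/2) (m + n) * fact m * fact n) * X ^ m * Y ^ n))))"
    unfolding scaled integrand by simp
  \<comment> \<open>The 2 undoes the third moment, \<open>b / a * (c / a)\<close> is the Jacobian,
    \<open>1 / a\<close> comes from the rescaled weight and pi from the summands.\<close>
  have "2 * pi * b * c / a ^ 3 = 2 * (b / a * (c / a) * (1 / a * pi))"
    by (simp add: power3_eq_cube)
  then have "ennreal (2 * pi * b * c / a ^ 3) = ennreal 2 * (ennreal (b / a * (c / a)) * (ennreal (1 / a) * ennreal pi))"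
    using pos by (simp only: ennreal_mult mult_nonneg_nonneg divide_nonneg_nonneg less_imp_le pi_ge_zero zero_le_numeral zero_le_one)
  then show ?thesis
    unfolding 1 2 by (simp only: mult.assoc)
qed

section \<open>Reduction of the area to the hemisphere integral\<close>

text \<open>Here \<open>k\<close> absorbs the term of the variable held fixed, so both partial
  derivatives are instances.\<close>

lemma deriv_half_ellipse:
  fixes c k A t :: real
  assumes "k - t\<^sup>2 / A > 0" and "A \<noteq> 0"
  shows "deriv (\<lambda>t. c * sqrt (k - t\<^sup>2 / A)) t = - (c * t / A) / sqrt (k - t\<^sup>2 / A)"
  using assms by (intro DERIV_imp_deriv) (auto intro!: derivative_eq_intros simp: field_simps)

text \<open>Scaling the ellipse to the unit disc gives the factors \<open>a\<close> and
  \<open>b\<close>; the factor \<open>c\<close> comes out of the integrand.\<close>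

lemma curved_surface_area_hemiellipsoid:
  assumes "a > 0" "b > 0" "c > 0"
  shows "curved_surface_area (hemiellipsoid a b c) (elliptical_region a b) =
    enn2real (ennreal (a * b * c) * hemi_int (ellipsoid_weight a b c))"
proof -
  define f where "f = (\<lambda>p. indicator (elliptical_region a b) p *\<^sub>R (case p of (x, y) \<Rightarrow>
     sqrt (1 + (deriv (\<lambda>t. hemiellipsoid a b c t y) x)\<^sup>2 + (deriv (\<lambda>t. hemiellipsoid a b c x t) y)\<^sup>2)))"
  define s where "s = (\<lambda>x y. 1 - x\<^sup>2 / a\<^sup>2 - y\<^sup>2 / b\<^sup>2)"
  \<comment> \<open>A Borel function that agrees with the integrand off the boundary ellipse, where
    \<open>deriv\<close> may be unspecified.\<close>
  define g where "g = (\<lambda>(x, y). if s x y > 0 then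
     sqrt (1 + (c * x / a\<^sup>2)\<^sup>2 / s x y + (c * y / b\<^sup>2)\<^sup>2 / s x y) else 0)"
  have "g \<in> borel_measurable (borel \<Otimes>\<^sub>M borel)"
    unfolding g_def s_def by measurable
  then have g[measurable]: "g \<in> borel_measurable borel"
    by (simp add: borel_prod)
  have g_nonneg: "g p \<ge> 0" for p
    by (auto simp: g_def split: prod.split)
  have fg: "g (x, y) = f (x, y)" if "s x y \<noteq> 0" for x y
  proof (cases "s x y > 0")
    case True
    then have "(x, y) \<in> elliptical_region a b"
      by (simp add: s_def elliptical_region_def)
    moreover have "deriv (\<lambda>t. hemiellipsoid a b c t y) x = - (c * x / a\<^sup>2) / sqrt (s x y)"
      using deriv_half_ellipse[of "1 - y\<^sup>2 / b\<^sup>2" x "a\<^sup>2" c] True assms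
      by (simp add: hemiellipsoid_def s_def algebra_simps)
    moreover have "deriv (\<lambda>t. hemiellipsoid a b c x t) y = - (c * y / b\<^sup>2) / sqrt (s x y)"
      using deriv_half_ellipse[of "1 - x\<^sup>2 / a\<^sup>2" y "b\<^sup>2" c] True assms
      by (simp add: hemiellipsoid_def s_def algebra_simps)
    ultimately show ?thesis
      using True by (simp add: f_def g_def power_divide power_mult_distrib)
  next
    case False
    with that show ?thesis
      by (simp add: f_def g_def elliptical_region_def s_def)
  qed
  have "AE p in lborel \<Otimes>\<^sub>M lborel. s (fst p) (snd p) \<noteq> 0"
  proof (rule lborel_pair.AE_pair_measure)
    show "{p \<in> space (lborel \<Otimes>\<^sub>M lborel). s (fst p) (snd p) \<noteq> 0} \<in> sets (lborel \<Otimes>\<^sub>M lborel)"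
      unfolding s_def by measurable
    have "AE y in lborel. s x y \<noteq> 0" for x
    proof -
      \<comment> \<open>A vertical line meets the boundary ellipse at most in the heights
        \<open>t\<close> and \<open>- t\<close>, so the boundary is null by slicing.\<close>
      define t where "t = b * sqrt (1 - x\<^sup>2 / a\<^sup>2)"
      have root: "y = t \<or> y = - t" if "s x y = 0" for y
      proof -
        have "1 - x\<^sup>2 / a\<^sup>2 = (y / b)\<^sup>2"
          using that by (simp add: s_def power_divide)
        then have "t = b * \<bar>y / b\<bar>" by (simp only: t_def real_sqrt_abs)
        then show ?thesis using \<open>b > 0\<close> by (auto simp: abs_if split: if_splits)
      qed
      show ?thesis
        using AE_lborel_singleton[of t] AE_lborel_singleton[of "- t"]
        by eventually_elim (use root in blast)
    qed
    then show "AE x in lborel. AE y in lborel. s (fst (x, y)) (snd (x, y)) \<noteq> 0"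
      by simp
  qed
  then have "AE p in lebesgue. g p = f p"
    unfolding lborel_prod by (intro AE_completion) (auto elim!: eventually_mono intro: fg)
  \<comment> \<open>Completeness of Lebesgue measure makes \<open>f\<close> measurable because it
    equals \<open>g\<close> almost everywhere.\<close>
  then have "(LINT p|lebesgue. f p) = (LINT p|lebesgue. g p)"
    using g by (intro integral_cong_AE borel_measurable_AE[of g f])
               (auto elim!: eventually_mono intro: measurable_completion)
  also have "\<dots> = enn2real (\<integral>\<^sup>+p. ennreal (g p) \<partial>lborel)"
    using g_nonneg by (simp add: integral_completion integral_eq_nn_integral)
  also have "(\<integral>\<^sup>+p. ennreal (g p) \<partial>lborel) = (\<integral>\<^sup>+x. \<integral>\<^sup>+y. ennreal (g (x, y)) \<partial>lborel \<partial>lborel)"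
    unfolding lborel_prod[symmetric] by (rule lborel.nn_integral_fst[symmetric]) (simp add: lborel_prod)
  also have "\<dots> = ennreal a * (\<integral>\<^sup>+x. \<integral>\<^sup>+y. ennreal (g (a * x, y)) \<partial>lborel \<partial>lborel)"
    by (subst nn_integral_real_affine[where c = a and t = 0]) (use assms in auto)
  also have "(\<integral>\<^sup>+x. \<integral>\<^sup>+y. ennreal (g (a * x, y)) \<partial>lborel \<partial>lborel) =
      (\<integral>\<^sup>+x. ennreal b * (\<integral>\<^sup>+y. ennreal (g (a * x, b * y)) \<partial>lborel) \<partial>lborel)"
    by (subst nn_integral_real_affine[where c = b and t = 0]) (use assms in auto)
  also have "\<dots> = (\<integral>\<^sup>+x. ennreal b * (\<integral>\<^sup>+y. ennreal c * (indicator {p. fst p ^ 2 + snd p ^ 2 < 1} (x, y) *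
     ennreal (1 / sqrt (1 - x\<^sup>2 - y\<^sup>2)) * ellipsoid_weight a b c (x, y, sqrt (1 - x\<^sup>2 - y\<^sup>2))) \<partial>lborel) \<partial>lborel)"
  proof (intro nn_integral_cong arg_cong2[where f = "(*)"] refl)
    fix x y :: real
    have s: "s (a * x) (b * y) = 1 - x\<^sup>2 - y\<^sup>2"
      using assms by (simp add: s_def power_mult_distrib)
    show "ennreal (g (a * x, b * y)) = ennreal c * (indicator {p. fst p ^ 2 + snd p ^ 2 < 1} (x, y) *
     ennreal (1 / sqrt (1 - x\<^sup>2 - y\<^sup>2)) * ellipsoid_weight a b c (x, y, sqrt (1 - x\<^sup>2 - y\<^sup>2)))"
    proof (cases "x\<^sup>2 + y\<^sup>2 < 1")
      case False
      then show ?thesis by (simp add: g_def s)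
    next
      case True
      define w where "w = 1 - x\<^sup>2 - y\<^sup>2"
      have "w > 0" using True by (simp add: w_def)
      \<comment> \<open>Factor out \<open>c^2 / w\<close>; the leading 1 becomes
        \<open>w / c^2\<close>, the z-term of the weight at height \<open>sqrt w\<close>.\<close>
      have "1 + (c * (a * x) / a\<^sup>2)\<^sup>2 / w + (c * (b * y) / b\<^sup>2)\<^sup>2 / w =
          (c / sqrt w)\<^sup>2 * (x\<^sup>2 / a\<^sup>2 + y\<^sup>2 / b\<^sup>2 + w / c\<^sup>2)"
        using assms \<open>w > 0\<close> by (simp add: power_divide field_simps power2_eq_square)
      then have "g (a * x, b * y) = c / sqrt w * sqrt (x\<^sup>2 / a\<^sup>2 + y\<^sup>2 / b\<^sup>2 + w / c\<^sup>2)"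
        using \<open>w > 0\<close> assms by (simp add: g_def s real_sqrt_mult real_sqrt_divide flip: w_def)
      then show ?thesis
        using True \<open>w > 0\<close> assms
        by (simp add: ellipsoid_weight_def flip: w_def ennreal_mult)
    qed
  qed
  also have "\<dots> = ennreal b * (ennreal c * hemi_int (ellipsoid_weight a b c))"
    unfolding hemi_int_def ellipsoid_weight_def
    by (simp add: nn_integral_cmult)
  also have "ennreal a * \<dots> = ennreal (a * b * c) * hemi_int (ellipsoid_weight a b c)"
    using assms by (simp add: ennreal_mult mult.assoc)
  finally show ?thesis
    unfolding curved_surface_area_def set_lebesgue_integral_def f_def .
qed

theorem theorem4:
  fixes a b c :: real
  assumes "a \<ge> b" and "b \<ge> c" and "c > 0"
    and "\<bar>1 - b\<^sup>2 / a\<^sup>2\<bar> < 1" and "\<bar>1 - c\<^sup>2 / a\<^sup>2\<bar> < 1"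
  shows "curved_surface_area (hemiellipsoid a b c) (elliptical_region a b) =
    2 * pi * b\<^sup>2 * c\<^sup>2 / a\<^sup>2
      * appell_F1 2 (1/2) (1/2) (3/2) (1 - b\<^sup>2 / a\<^sup>2) (1 - c\<^sup>2 / a\<^sup>2)"
proof -
  have pos: "a > 0" "b > 0" "c > 0"
    using assms by auto
  have nonneg: "0 \<le> 1 - b\<^sup>2 / a\<^sup>2" "0 \<le> 1 - c\<^sup>2 / a\<^sup>2"
    using assms pos by auto
  \<comment> \<open>\<open>enn2real\<close> is multiplicative even at infinity, so the constants
    come out of it.\<close>
  have "curved_surface_area (hemiellipsoid a b c) (elliptical_region a b) =
      a * b * c * (2 * pi * b * c / a ^ 3 * appell_F1 2 (1/2) (1/2) (3/2) (1 - b\<^sup>2 / a\<^sup>2) (1 - c\<^sup>2 / a\<^sup>2))"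
    using pos nonneg assms
    by (simp add: curved_surface_area_hemiellipsoid hemi_int_ellipsoid_weight appell_F1_eq_enn2real enn2real_mult)
  also have "\<dots> = 2 * pi * b\<^sup>2 * c\<^sup>2 / a\<^sup>2
      * appell_F1 2 (1/2) (1/2) (3/2) (1 - b\<^sup>2 / a\<^sup>2) (1 - c\<^sup>2 / a\<^sup>2)"
    using pos by (simp add: power2_eq_square power3_eq_cube)
  finally show ?thesis .
qed

end
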